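(* Let $B$ be a nonempty string over $\{\mathrm{H},\mathrm{T}\}$ starting with $\mathrm{H}$, chosen by Bob. Then the No-Flippancy game with Bob's string $B$ is finite for every choice of Alice's string $A\neq B$ of the same length as $B$ if and only if $B\in\{\mathrm{H},\mathrm{HT},\mathrm{HTH},\mathrm{HTHT},\mathrm{HTHTH}\}$.
   Context: No-Flippancy game: Alice and Bob have distinct strings $A=A_1\cdots A_n$ and $B=B_1\cdots B_n$ of the same length $n$ over the alphabet $\{\mathrm{H},\mathrm{T}\}$. Starting from the empty sequence, the players alternate turns, Alice going first, and on each turn the current player appends one letter to the sequence (the game output) as follows: let $i<n$ be the maximal length of a suffix of the current sequence that coincides with a prefix of the current player's string ($i=0$ is allowed, via the empty suffix); the player appends the letter with index $i+1$ of their own string. The game ends as soon as $A$ or $B$ appears as a block of consecutive letters in the sequence (necessarily as its suffix, no matter who made the last move); the player whose string appears first wins. If neither string ever appears, the game is infinite; otherwise it is finite. *)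

theory Defs
  imports Main "HOL-Library.Sublist"
begin

datatype coin = H | T

definition overlap :: "coin list \<Rightarrow> coin list \<Rightarrow> nat" where
  "overlap P s = Max {i. i < length P \<and> suffix (take i P) s}"

(* Strings are 0-indexed here, so the (i+1)-st letter of P is P ! i. *)
definition append_letter :: "coin list \<Rightarrow> coin list \<Rightarrow> coin list" where
  "append_letter P s = s @ [P ! overlap P s]"

definition game_over :: "coin list \<Rightarrow> coin list \<Rightarrow> coin list \<Rightarrow> bool" where
  "game_over A B s \<longleftrightarrow> sublist A s \<or> sublist B s"

(* Game output after k turns. Turns are numbered from 0, so Alice moves on the even ones.
   Once the game is over the output no longer changes. *)
primrec sequence :: "coin list \<Rightarrow> coin list \<Rightarrow> nat \<Rightarrow> coin list" where
  "sequence A B 0 = []"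
| "sequence A B (Suc k) =
     (let s = sequence A B k in
      if game_over A B s then s
      else append_letter (if even k then A else B) s)"

definition finite_game :: "coin list \<Rightarrow> coin list \<Rightarrow> bool" where
  "finite_game A B \<longleftrightarrow> (\<exists>k. game_over A B (sequence A B k))"

end

theory Submission
  imports Defs
begin

text \<open>
  If \<open>B\<close> has two equal adjacent letters, let \<open>dd\<close> be the first such pair. Against the constant
  string of the other letter, Bob always answers with \<open>d\<close>: a prefix of \<open>B\<close> that matches the
  end of the alternating output cannot contain the pair, and it ends with Alice's letter rather
  than \<open>d\<close>, so it stops before the pair and its next letter is again \<open>d\<close>; and if no nonempty
  prefix matches, then \<open>B\<close> starts with \<open>d\<close>. The output alternates forever, while both strings
  contain a repeated letter. If \<open>B = HTHT\<dots>\<close> has length at least 6, Alice takes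
  \<open>HTTHH\<dots>H\<close>. Then the output is \<open>HTTH\<close> repeated forever; it contains neither \<open>HHH\<close> nor
  \<open>HTH\<close>, hence neither string. The five remaining strings \<open>B\<close> are checked by playing out all
  games, which end within eight turns.
\<close>

section \<open>Exhaustive play against the five short strings\<close>

lemma overlap_code [code]:
  "overlap P s = Max (set (filter (\<lambda>i. suffix (take i P) s) [0..<length P]))"
  unfolding overlap_def by (rule arg_cong[of _ _ Max]) auto

text \<open>As rewrite rules these unfold a quantifier over all strings of a fixed length into
  finitely many concrete games, which evaluation can decide.\<close>

lemma all_coin_lists_of_length:
  "(\<forall>A. length A = 0 \<longrightarrow> P A) \<longleftrightarrow> P []"
  "(\<forall>A :: coin list. length A = Suc n \<longrightarrow> P A) \<longleftrightarrow>
    (\<forall>A. length A = n \<longrightarrow> P (H # A)) \<and> (\<forall>A. length A = n \<longrightarrow> P (T # A))"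
proof -
  have coin: "(\<forall>c. Q c) \<longleftrightarrow> Q H \<and> Q T" for Q
    by (metis coin.exhaust)
  have "(\<forall>A. length A = Suc n \<longrightarrow> P A) \<longleftrightarrow> (\<forall>c A. length A = n \<longrightarrow> P (c # A))"
    by (auto simp: length_Suc_conv)
  then show "(\<forall>A. length A = Suc n \<longrightarrow> P A) \<longleftrightarrow>
      (\<forall>A. length A = n \<longrightarrow> P (H # A)) \<and> (\<forall>A. length A = n \<longrightarrow> P (T # A))"
    by (simp only: coin)
qed simp

lemma finite_game_short_alternating:
  assumes "B \<in> {[H], [H, T], [H, T, H], [H, T, H, T], [H, T, H, T, H]}"
    and "length A = length B" and "A \<noteq> B"
  shows "finite_game A B"
proof -
  \<comment> \<open>The output is frozen once the game is over, so a single turn count serves all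
    opponents. \<open>overlap_code\<close> makes the games executable.\<close>
  have "\<forall>A. length A = length B \<longrightarrow> A \<noteq> B \<longrightarrow> game_over A B (sequence A B 8)"
    using assms(1)
    by (elim insertE emptyE; simp only: list.size(3) length_Cons all_coin_lists_of_length;
        intro conjI; code_simp)
  then show ?thesis
    using assms(2,3) unfolding finite_game_def by blast
qed

section \<open>Overlaps with prefixes of an infinite word\<close>

lemma overlap_props:
  assumes "P \<noteq> []"
  shows overlap_less: "overlap P s < length P"
    and suffix_overlap: "suffix (take (overlap P s) P) s"
proof -
  let ?I = "{i. i < length P \<and> suffix (take i P) s}"
  have "finite ?I" "0 \<in> ?I"
    using assms by auto
  then have "overlap P s \<in> ?I"
    unfolding overlap_def by (intro Max_in) blast+
  then show "overlap P s < length P" "suffix (take (overlap P s) P) s"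
    by auto
qed

lemma overlap_ge:
  assumes "i < length P" and "suffix (take i P) s"
  shows "i \<le> overlap P s"
  unfolding overlap_def using assms by (intro Max_ge) auto

lemma sublist_map_upt_nth:
  assumes "sublist P (map w [0..<k])"
  shows "\<exists>b. \<forall>j<length P. P ! j = w (b + j)"
proof -
  obtain xs ys where eq: "map w [0..<k] = xs @ P @ ys"
    using assms by (auto simp: sublist_def)
  have "P ! j = w (length xs + j)" if "j < length P" for j
  proof -
    have "length xs + j < k"
      using arg_cong[OF eq, of length] that by simp
    moreover have "(xs @ P @ ys) ! (length xs + j) = P ! j"
      using that by (simp add: nth_append)
    ultimately show ?thesis
      using eq by (metis add_0 diff_zero nth_map_upt)
  qed
  then show ?thesis by blast
qed

lemma suffix_map_upt_iff:
  "suffix P (map w [0..<k]) \<longleftrightarrow>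
    length P \<le> k \<and> (\<forall>j<length P. P ! j = w (k - length P + j))"
proof -
  have "suffix P s \<longleftrightarrow> length P \<le> length s \<and> drop (length s - length P) s = P" for s
    by (metis append_take_drop_id suffix_length_le suffix_def suffix_take
        add_diff_cancel_right' append_eq_conv_conj length_append)
  then show ?thesis
    by (auto simp: drop_map list_eq_iff_nth_eq)
qed

lemma overlap_map_upt:
  assumes "P \<noteq> []" and "i = overlap P (map w [0..<k])"
  shows "i < length P" and "i \<le> k" and "\<And>j. j < i \<Longrightarrow> P ! j = w (k - i + j)"
proof -
  show i: "i < length P"
    using overlap_less assms by simp
  have "suffix (take i P) (map w [0..<k])"
    using suffix_overlap assms by simp
  then show "i \<le> k" "\<And>j. j < i \<Longrightarrow> P ! j = w (k - i + j)"
    using i by (auto simp: suffix_map_upt_iff)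
qed

text \<open>Any matching prefix bounds the overlap from below; upper bounds come from refuting the
  letter equations of \<open>overlap_map_upt\<close>.\<close>

lemma overlap_map_upt_ge:
  assumes "i < length P" and "i \<le> k" and "\<And>j. j < i \<Longrightarrow> P ! j = w (k - i + j)"
  shows "i \<le> overlap P (map w [0..<k])"
  using assms by (intro overlap_ge) (auto simp: suffix_map_upt_iff)

text \<open>Here \<open>w\<close> is the predicted infinite output. Induction on \<open>k\<close>
  shows that play follows it, since \<open>never\<close> keeps the game from stopping.\<close>

lemma infinite_game:
  assumes never: "\<And>k. \<not> sublist A (map w [0..<k])" "\<And>k. \<not> sublist B (map w [0..<k])"
    and alice: "\<And>k. even k \<Longrightarrow> A ! overlap A (map w [0..<k]) = w k"
    and bob: "\<And>k. odd k \<Longrightarrow> B ! overlap B (map w [0..<k]) = w k"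
  shows "\<not> finite_game A B"
proof -
  have "sequence A B k = map w [0..<k]" for k
    using never alice bob
    by (induction k) (simp_all add: game_over_def append_letter_def)
  then show ?thesis
    using never by (simp add: finite_game_def game_over_def)
qed

section \<open>Strings with two equal adjacent letters\<close>

fun flip :: "coin \<Rightarrow> coin" where
  "flip H = T"
| "flip T = H"

lemma flip_neq [simp]: "flip c \<noteq> c" "c \<noteq> flip c"
  by (cases c; simp)+

lemma neq_iff_flip: "c \<noteq> d \<longleftrightarrow> c = flip d"
  by (cases c; cases d) auto

lemma infinite_game_repeated_letter:
  assumes "Suc m < length B" and "B ! m = B ! Suc m"
  shows "\<exists>A. length A = length B \<and> A \<noteq> B \<and> \<not> finite_game A B"
proof -
  \<comment> \<open>Minimality makes the letters of \<open>B\<close> alternate up to index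
    \<open>m\<close>.\<close>
  define m where "m = (LEAST m. Suc m < length B \<and> B ! m = B ! Suc m)"
  have m: "Suc m < length B" "B ! m = B ! Suc m"
    using LeastI[of "\<lambda>m. Suc m < length B \<and> B ! m = B ! Suc m"] assms
    unfolding m_def by blast+
  have alternating: "B ! Suc i = flip (B ! i)" if "i < m" for i
  proof -
    have "\<not> (Suc i < length B \<and> B ! i = B ! Suc i)"
      using not_less_Least[OF that[unfolded m_def]] .
    then show ?thesis
      using that m(1) neq_iff_flip[of "B ! Suc i" "B ! i"] by auto
  qed
  define d where "d = B ! m"
  define A where "A = replicate (length B) (flip d)"
  define w where "w k = (if even k then flip d else d)" for k :: nat
  have w_Suc: "w (Suc k) \<noteq> w k" for k
    by (simp add: w_def)
  have "B \<noteq> []"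
    using m by auto
  have "\<not> finite_game A B"
  proof (rule infinite_game)
    fix k
    show "\<not> sublist A (map w [0..<k])"
    proof
      assume "sublist A (map w [0..<k])"
      then obtain b where "\<And>j. j < length A \<Longrightarrow> A ! j = w (b + j)"
        using sublist_map_upt_nth by blast
      from this[of 0] this[of 1] show False
        using m \<open>B \<noteq> []\<close> w_Suc[of b] by (simp add: A_def)
    qed
    show "\<not> sublist B (map w [0..<k])"
    proof
      assume "sublist B (map w [0..<k])"
      then obtain b where "\<And>j. j < length B \<Longrightarrow> B ! j = w (b + j)"
        using sublist_map_upt_nth by blast
      from this[of m] this[of "Suc m"] show False
        using m w_Suc[of "b + m"] by simp
    qed
  next
    fix k :: nat
    assume "even k"
    have "A \<noteq> []"
      using m by (auto simp: A_def)
    then show "A ! overlap A (map w [0..<k]) = w k"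
      using overlap_less[of A] \<open>even k\<close> by (simp add: A_def w_def)
  next
    fix k :: nat
    assume "odd k"
    then have last: "w (k - 1) = flip d" and "0 < k"
      by (auto simp: w_def elim: oddE)
    define i where "i = overlap B (map w [0..<k])"
    note i = overlap_map_upt[OF \<open>B \<noteq> []\<close> i_def]
    have "B ! i = d"
    proof (cases i)
      case 0
      have "B ! 0 \<noteq> flip d"
      proof
        assume "B ! 0 = flip d"
        \<comment> \<open>Alice's last letter alone would be a matching prefix of length 1.\<close>
        then have "1 \<le> i"
          unfolding i_def using m \<open>0 < k\<close> last by (intro overlap_map_upt_ge) auto
        then show False using 0 by simp
      qed
      then show ?thesis
        using 0 neq_iff_flip by auto
    next
      case (Suc l)
      \<comment> \<open>A longer match would put the equal letters at \<open>m\<close> and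
        \<open>Suc m\<close> into the alternating word \<open>w\<close>.\<close>
      have "l < Suc m"
      proof (rule ccontr)
        assume "\<not> l < Suc m"
        then show False
          using i(3)[of m] i(3)[of "Suc m"] m w_Suc[of "k - i + m"] Suc by simp
      qed
      \<comment> \<open>The matched prefix ends with Alice's last letter.\<close>
      moreover have l: "B ! l = flip d"
        using i(2) i(3)[of l] last Suc by (simp add: algebra_simps)
      then have "l \<noteq> m"
        using d_def by force
      ultimately have "B ! Suc l = flip (B ! l)"
        using alternating by simp
      then show ?thesis
        using l Suc by (cases d) auto
    qed
    then show "B ! overlap B (map w [0..<k]) = w k"
      using \<open>odd k\<close> by (simp add: i_def w_def)
  qed
  moreover have "A \<noteq> B"
    using m d_def by (auto simp: A_def) (metis Suc_lessD flip_neq(1) nth_replicate)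
  ultimately show ?thesis
    by (intro exI[of _ A]) (simp add: A_def)
qed

section \<open>Alternating strings of length at least six\<close>

lemma infinite_game_long_alternating:
  assumes n: "6 \<le> length B"
    and B: "\<And>i. i < length B \<Longrightarrow> B ! i = (if even i then H else T)"
  shows "\<exists>A. length A = length B \<and> A \<noteq> B \<and> \<not> finite_game A B"
proof -
  have "B \<noteq> []"
    using n by auto
  \<comment> \<open>At least three letters \<open>H\<close> follow \<open>HTT\<close>, so
    \<open>A\<close> contains \<open>HHH\<close>.\<close>
  define A where "A = [H, T, T] @ replicate (length B - 3) H"
  have len: "length A = length B"
    using n by (simp add: A_def)
  have A: "A ! i = (if i = 1 \<or> i = 2 then T else H)" if "i < length B" for i
    using that n by (auto simp: A_def nth_append nth_Cons split: nat.split)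
  define w where "w k = (if k mod 4 \<in> {1, 2} then T else H)" for k :: nat
  have mod_4: "b mod 4 = 0 \<or> b mod 4 = 1 \<or> b mod 4 = 2 \<or> b mod 4 = 3" for b :: nat
    by linarith
  have no_HHH: "\<not> (w b = H \<and> w (b + 1) = H \<and> w (b + 2) = H)" for b
    using mod_4[of b] by (elim disjE) (simp_all add: w_def mod_Suc)
  have no_HTH: "\<not> (w b = H \<and> w (b + 1) = T \<and> w (b + 2) = H)" for b
    using mod_4[of b] by (elim disjE) (simp_all add: w_def mod_Suc)
  have "\<not> finite_game A B"
  proof (rule infinite_game)
    fix k
    show "\<not> sublist A (map w [0..<k])"
    proof
      assume "sublist A (map w [0..<k])"
      then obtain b where "\<And>j. j < length A \<Longrightarrow> A ! j = w (b + j)"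
        using sublist_map_upt_nth by blast
      from this[of 3] this[of 4] this[of 5] show False
        using n no_HHH[of "b + 3"] by (simp add: A len add_ac)
    qed
    show "\<not> sublist B (map w [0..<k])"
    proof
      assume "sublist B (map w [0..<k])"
      then obtain b where "\<And>j. j < length B \<Longrightarrow> B ! j = w (b + j)"
        using sublist_map_upt_nth by blast
      from this[of 0] this[of 1] this[of 2] show False
        using n \<open>B \<noteq> []\<close> no_HTH[of b] by (simp add: B)
    qed
  next
    fix k :: nat
    assume "even k"
    define i where "i = overlap A (map w [0..<k])"
    have "A \<noteq> []"
      by (simp add: A_def)
    note i = overlap_map_upt[OF this i_def, unfolded len]
    \<comment> \<open>The form \<open>4 * q + 4\<close> keeps \<open>k - 4\<close> from being
      truncated.\<close>
    consider "k = 0" | q where "k = 4 * q + 4" | q where "k = 4 * q + 2"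
      using \<open>even k\<close> by atomize_elim presburger
    then have "A ! i = w k"
    proof cases
      case 1
      then show ?thesis
        using i by (simp add: A w_def mod_Suc)
    next
      case 2
      \<comment> \<open>The output ends with \<open>HTTH\<close>. The exact overlap is irrelevant,
        because \<open>A\<close> has only \<open>H\<close> from index 3 on.\<close>
      have "4 \<le> i"
        unfolding i_def
      proof (rule overlap_map_upt_ge)
        fix j :: nat
        assume "j < 4"
        then have "j = 0 \<or> j = 1 \<or> j = 2 \<or> j = 3" by linarith
        then show "A ! j = w (k - 4 + j)"
          using n \<open>B \<noteq> []\<close> 2 by (elim disjE) (simp_all add: A w_def mod_Suc)
      qed (use n 2 len in auto)
      then show ?thesis
        using i(1) 2 by (simp add: A w_def mod_Suc)
    next
      case 3
      have "2 \<le> i"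
        unfolding i_def
      proof (rule overlap_map_upt_ge)
        fix j :: nat
        assume "j < 2"
        then have "j = 0 \<or> j = 1" by linarith
        then show "A ! j = w (k - 2 + j)"
          using n \<open>B \<noteq> []\<close> 3 by (elim disjE) (simp_all add: A w_def mod_Suc)
      qed (use n 3 len in auto)
      \<comment> \<open>The output ends with \<open>HT\<close>, which occurs in \<open>A\<close>
        only at the very beginning.\<close>
      moreover have "\<not> 2 < i"
      proof
        assume "2 < i"
        have ends: "w (k - 1) = T" "w (k - 2) = H"
          using 3 by (simp_all add: w_def mod_Suc)
        have "A ! (i - 1) = w (k - 1)" "A ! (i - 2) = w (k - 2)"
          using i(2) i(3)[of "i - 1"] i(3)[of "i - 2"] \<open>2 < i\<close> by simp_all
        then show False
          using ends i(1) \<open>2 < i\<close> by (auto simp: A split: if_splits)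
      qed
      ultimately have "i = 2" by simp
      then show ?thesis
        using n 3 by (simp add: A w_def mod_Suc)
    qed
    then show "A ! overlap A (map w [0..<k]) = w k"
      by (simp add: i_def)
  next
    fix k :: nat
    assume "odd k"
    define i where "i = overlap B (map w [0..<k])"
    note i = overlap_map_upt[OF \<open>B \<noteq> []\<close> i_def]
    \<comment> \<open>A longer match would contain \<open>HTH\<close>.\<close>
    have "i \<le> 2"
    proof (rule ccontr)
      assume "\<not> i \<le> 2"
      then show False
        using i(1) i(3)[of 0] i(3)[of 1] i(3)[of 2] n \<open>B \<noteq> []\<close> no_HTH[of "k - i"] by (simp add: B)
    qed
    consider q where "k = 4 * q + 1" | q where "k = 4 * q + 3"
      using \<open>odd k\<close> by atomize_elim presburger
    then have "B ! i = w k"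
    proof cases
      case 1
      have "1 \<le> i"
        unfolding i_def using n \<open>B \<noteq> []\<close> 1 by (intro overlap_map_upt_ge) (auto simp: B w_def mod_Suc)
      moreover have "i \<noteq> 2"
      proof
        assume "i = 2"
        \<comment> \<open>By \<open>i \<le> k\<close> the subtraction is exact. The match
          \<open>HT\<close> would have to end at \<open>4 * q\<close>, where \<open>w\<close> has
          \<open>H\<close>.\<close>
        then have "k - i + 1 = 4 * q"
          using i(2) 1 by simp
        then show False
          using i(3)[of 1] \<open>i = 2\<close> n by (simp add: B w_def)
      qed
      ultimately have "i = 1"
        using \<open>i \<le> 2\<close> by simp
      then show ?thesis
        using n \<open>B \<noteq> []\<close> 1 by (simp add: B w_def mod_Suc)
    next
      case 2
      \<comment> \<open>A match of length 1 or 2 would need its initial \<open>H\<close> at one of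
        these two places.\<close>
      have "w (k - 1) = T" "w (k - 2) = T"
        using 2 by (simp_all add: w_def mod_Suc)
      then have "i \<noteq> 1" "i \<noteq> 2"
        using i(3)[of 0] n \<open>B \<noteq> []\<close> by (auto simp: B)
      then have "i = 0"
        using \<open>i \<le> 2\<close> by simp
      then show ?thesis
        using n \<open>B \<noteq> []\<close> 2 by (simp add: B w_def mod_Suc)
    qed
    then show "B ! overlap B (map w [0..<k]) = w k"
      by (simp add: i_def)
  qed
  moreover have "A \<noteq> B"
    using A[of 2] B[of 2] n by auto
  ultimately show ?thesis
    using len by blast
qed

section \<open>The classification\<close>

lemma short_alternating:
  assumes "B \<noteq> []" and "length B < 6"
    and "\<And>i. i < length B \<Longrightarrow> B ! i = (if even i then H else T)"
  shows "B \<in> {[H], [H, T], [H, T, H], [H, T, H, T], [H, T, H, T, H]}"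
proof -
  have "B = map (\<lambda>i. if even i then H else T) [0..<length B]"
    using assms(3) by (intro nth_equalityI) auto
  moreover have "length B = 1 \<or> length B = 2 \<or> length B = 3 \<or> length B = 4 \<or> length B = 5"
    using assms(1,2) length_greater_0_conv[of B] by linarith
  ultimately show ?thesis
    by (elim disjE) (simp_all add: upt_rec)
qed

theorem lemma3:
  fixes B :: "coin list"
  assumes "B \<noteq> []"
    and "hd B = H"
  shows "(\<forall>A. length A = length B \<and> A \<noteq> B \<longrightarrow> finite_game A B) \<longleftrightarrow>
    B \<in> {[H], [H, T], [H, T, H], [H, T, H, T], [H, T, H, T, H]}"
proof
  assume finite: "\<forall>A. length A = length B \<and> A \<noteq> B \<longrightarrow> finite_game A B"
  then have neq: "B ! Suc i = flip (B ! i)" if "Suc i < length B" for i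
    using infinite_game_repeated_letter that neq_iff_flip by metis
  have alternating: "B ! i = (if even i then H else T)" if "i < length B" for i
    using that
  proof (induction i)
    case 0
    then show ?case
      using assms by (simp add: hd_conv_nth)
  next
    case (Suc i)
    then show ?case
      using neq[of i] by simp
  qed
  then have "length B < 6"
    using infinite_game_long_alternating finite by (meson not_le)
  then show "B \<in> {[H], [H, T], [H, T, H], [H, T, H, T], [H, T, H, T, H]}"
    using short_alternating assms(1) alternating by blast
next
  assume "B \<in> {[H], [H, T], [H, T, H], [H, T, H, T], [H, T, H, T, H]}"
  then show "\<forall>A. length A = length B \<and> A \<noteq> B \<longrightarrow> finite_game A B"
    using finite_game_short_alternating by blast
qed

end
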